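(* Let $\mathcal{A}$ be a locally noetherian Grothendieck category such that $\mathrm{ASpec}\,\mathcal{A}$ is an Alexandroff topological space, and let $\alpha\in\mathrm{ASpec}\,\mathcal{A}$. Then every monoform object $H$ with $\alpha=\overline{H}$ contains a monoform subobject $H_1$ such that $\mathrm{ASupp}(H_1)=\{\beta\in\mathrm{ASpec}\,\mathcal{A}\mid\alpha\le\beta\}$.
   Context: A nonzero object $H$ of $\mathcal{A}$ is monoform if for every nonzero subobject $N$ of $H$, no nonzero subobject of $H$ is isomorphic to a subobject of $H/N$. Two monoform objects are atom-equivalent if they have isomorphic nonzero subobjects (this is an equivalence relation); the class of $H$ is denoted $\overline{H}$ and called an atom; $\mathrm{ASpec}\,\mathcal{A}$ is the set of atoms. For an object $M$, $\mathrm{ASupp}(M)$ is the set of atoms $\alpha$ such that some $H\in\alpha$ is a subquotient of $M$. $\mathrm{ASpec}\,\mathcal{A}$ is a topological space in which a subset $\Phi$ is open if for every $\alpha\in\Phi$ there is $H\in\alpha$ with $\mathrm{ASupp}(H)\subseteq\Phi$. The specialization order: $\alpha\le\beta$ if every open subset containing $\alpha$ contains $\beta$. A topological space is Alexandroff if the intersection of any family of open subsets is open. *)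

theory Defs
  imports "HOL-Algebra.Group" "HOL-Analysis.Abstract_Topology"
begin

section \<open>Preadditive categories\<close>

text \<open>
  Data of a category with objects in \<^typ>\<open>'o\<close> and morphisms in \<^typ>\<open>'m\<close>, whose Hom-sets carry
  an addition. \<open>g \<cdot> f\<close> is composition in the order of functions (first \<open>f\<close>, then \<open>g\<close>);
  \<open>Zer C X Y\<close> is the neutral element of \<open>Hom C X Y\<close>.
\<close>

record ('o, 'm) addcat =
  Ob :: "'o set"
  Ar :: "'m set"
  Dom :: "'m \<Rightarrow> 'o"
  Cod :: "'m \<Rightarrow> 'o"
  Idt :: "'o \<Rightarrow> 'm"
  Comp :: "'m \<Rightarrow> 'm \<Rightarrow> 'm"  (infixl "\<cdot>\<index>" 70)
  Plus :: "'m \<Rightarrow> 'm \<Rightarrow> 'm"  (infixl "\<oplus>\<index>" 65)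
  Zer :: "'o \<Rightarrow> 'o \<Rightarrow> 'm"

definition Hom :: "('o, 'm) addcat \<Rightarrow> 'o \<Rightarrow> 'o \<Rightarrow> 'm set" where
  "Hom C X Y = {f \<in> Ar C. Dom C f = X \<and> Cod C f = Y}"

locale category =
  fixes C :: "('o, 'm) addcat" (structure)
  assumes Dom_Ob: "f \<in> Ar C \<Longrightarrow> Dom C f \<in> Ob C"
    and Cod_Ob: "f \<in> Ar C \<Longrightarrow> Cod C f \<in> Ob C"
    and Idt_Hom: "X \<in> Ob C \<Longrightarrow> Idt C X \<in> Hom C X X"
    and Comp_Hom: "f \<in> Hom C X Y \<Longrightarrow> g \<in> Hom C Y Z \<Longrightarrow> g \<cdot> f \<in> Hom C X Z"
    and Comp_assoc: "f \<in> Hom C W X \<Longrightarrow> g \<in> Hom C X Y \<Longrightarrow> h \<in> Hom C Y Z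
      \<Longrightarrow> (h \<cdot> g) \<cdot> f = h \<cdot> (g \<cdot> f)"
    and Comp_Idt: "f \<in> Hom C X Y \<Longrightarrow> f \<cdot> Idt C X = f"
    and Idt_Comp: "f \<in> Hom C X Y \<Longrightarrow> Idt C Y \<cdot> f = f"

locale preadditive_category = category +
  assumes Hom_group: "X \<in> Ob C \<Longrightarrow> Y \<in> Ob C
      \<Longrightarrow> comm_group \<lparr>carrier = Hom C X Y, monoid.mult = Plus C, one = Zer C X Y\<rparr>"
    and Comp_Plus_right: "f \<in> Hom C X Y \<Longrightarrow> f' \<in> Hom C X Y \<Longrightarrow> g \<in> Hom C Y Z
      \<Longrightarrow> g \<cdot> (f \<oplus> f') = g \<cdot> f \<oplus> g \<cdot> f'"
    and Comp_Plus_left: "f \<in> Hom C X Y \<Longrightarrow> g \<in> Hom C Y Z \<Longrightarrow> g' \<in> Hom C Y Z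
      \<Longrightarrow> (g \<oplus> g') \<cdot> f = g \<cdot> f \<oplus> g' \<cdot> f"


section \<open>Categorical notions\<close>

definition is_mono :: "('o, 'm) addcat \<Rightarrow> 'm \<Rightarrow> bool" where
  "is_mono C f \<longleftrightarrow> f \<in> Ar C \<and>
    (\<forall>X. \<forall>g\<in>Hom C X (Dom C f). \<forall>h\<in>Hom C X (Dom C f).
      f \<cdot>\<^bsub>C\<^esub> g = f \<cdot>\<^bsub>C\<^esub> h \<longrightarrow> g = h)"

definition is_epi :: "('o, 'm) addcat \<Rightarrow> 'm \<Rightarrow> bool" where
  "is_epi C f \<longleftrightarrow> f \<in> Ar C \<and>
    (\<forall>X. \<forall>g\<in>Hom C (Cod C f) X. \<forall>h\<in>Hom C (Cod C f) X.
      g \<cdot>\<^bsub>C\<^esub> f = h \<cdot>\<^bsub>C\<^esub> f \<longrightarrow> g = h)"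

definition isomorphic :: "('o, 'm) addcat \<Rightarrow> 'o \<Rightarrow> 'o \<Rightarrow> bool" where
  "isomorphic C X Y \<longleftrightarrow> X \<in> Ob C \<and> Y \<in> Ob C \<and>
    (\<exists>f\<in>Hom C X Y. \<exists>g\<in>Hom C Y X. g \<cdot>\<^bsub>C\<^esub> f = Idt C X \<and> f \<cdot>\<^bsub>C\<^esub> g = Idt C Y)"

definition is_zero_object :: "('o, 'm) addcat \<Rightarrow> 'o \<Rightarrow> bool" where
  "is_zero_object C X \<longleftrightarrow> X \<in> Ob C \<and>
    (\<forall>Y\<in>Ob C. (\<exists>!f. f \<in> Hom C X Y) \<and> (\<exists>!f. f \<in> Hom C Y X))"

definition is_kernel :: "('o, 'm) addcat \<Rightarrow> 'm \<Rightarrow> 'm \<Rightarrow> bool" where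
  "is_kernel C k f \<longleftrightarrow> f \<in> Ar C \<and> k \<in> Ar C \<and> Cod C k = Dom C f \<and>
    f \<cdot>\<^bsub>C\<^esub> k = Zer C (Dom C k) (Cod C f) \<and>
    (\<forall>X. \<forall>g\<in>Hom C X (Dom C f). f \<cdot>\<^bsub>C\<^esub> g = Zer C X (Cod C f)
      \<longrightarrow> (\<exists>!h. h \<in> Hom C X (Dom C k) \<and> k \<cdot>\<^bsub>C\<^esub> h = g))"

definition is_cokernel :: "('o, 'm) addcat \<Rightarrow> 'm \<Rightarrow> 'm \<Rightarrow> bool" where
  "is_cokernel C q f \<longleftrightarrow> f \<in> Ar C \<and> q \<in> Ar C \<and> Dom C q = Cod C f \<and>
    q \<cdot>\<^bsub>C\<^esub> f = Zer C (Dom C f) (Cod C q) \<and>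
    (\<forall>X. \<forall>g\<in>Hom C (Cod C f) X. g \<cdot>\<^bsub>C\<^esub> f = Zer C (Dom C f) X
      \<longrightarrow> (\<exists>!h. h \<in> Hom C (Cod C q) X \<and> h \<cdot>\<^bsub>C\<^esub> q = g))"

definition is_coproduct ::
    "('o, 'm) addcat \<Rightarrow> 'i set \<Rightarrow> ('i \<Rightarrow> 'o) \<Rightarrow> 'o \<Rightarrow> ('i \<Rightarrow> 'm) \<Rightarrow> bool" where
  "is_coproduct C I X S \<iota> \<longleftrightarrow> S \<in> Ob C \<and> (\<forall>i\<in>I. \<iota> i \<in> Hom C (X i) S) \<and>
    (\<forall>T\<in>Ob C. \<forall>g. (\<forall>i\<in>I. g i \<in> Hom C (X i) T)
      \<longrightarrow> (\<exists>!h. h \<in> Hom C S T \<and> (\<forall>i\<in>I. h \<cdot>\<^bsub>C\<^esub> \<iota> i = g i)))"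

text \<open>Binary coproducts are biproducts in any preadditive category.\<close>

locale abelian_category = preadditive_category +
  assumes ex_zero_object: "\<exists>Z. is_zero_object C Z"
    and ex_binary_coproduct: "X \<in> Ob C \<Longrightarrow> Y \<in> Ob C
      \<Longrightarrow> \<exists>S \<iota>. is_coproduct C (UNIV :: bool set) (\<lambda>b. if b then X else Y) S \<iota>"
    and ex_kernel: "f \<in> Ar C \<Longrightarrow> \<exists>k. is_kernel C k f"
    and ex_cokernel: "f \<in> Ar C \<Longrightarrow> \<exists>q. is_cokernel C q f"
    and mono_is_kernel: "is_mono C f \<Longrightarrow> \<exists>g. is_kernel C f g"
    and epi_is_cokernel: "is_epi C f \<Longrightarrow> \<exists>g. is_cokernel C f g"

text \<open>\<open>0 \<rightarrow> X \<rightarrow> Y \<rightarrow> Z \<rightarrow> 0\<close> is exact, where \<open>f : X \<rightarrow> Y\<close> and \<open>g : Y \<rightarrow> Z\<close>.\<close>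

definition short_exact :: "('o, 'm) addcat \<Rightarrow> 'm \<Rightarrow> 'm \<Rightarrow> bool" where
  "short_exact C f g \<longleftrightarrow> is_kernel C f g \<and> is_cokernel C g f"


section \<open>Direct limits\<close>

definition directed_set :: "'i set \<Rightarrow> ('i \<Rightarrow> 'i \<Rightarrow> bool) \<Rightarrow> bool" where
  "directed_set I R \<longleftrightarrow> I \<noteq> {} \<and> (\<forall>i\<in>I. R i i) \<and>
    (\<forall>i\<in>I. \<forall>j\<in>I. \<forall>k\<in>I. R i j \<longrightarrow> R j k \<longrightarrow> R i k) \<and>
    (\<forall>i\<in>I. \<forall>j\<in>I. \<exists>k\<in>I. R i k \<and> R j k)"

definition direct_system :: "('o, 'm) addcat \<Rightarrow> 'i set \<Rightarrow> ('i \<Rightarrow> 'i \<Rightarrow> bool)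
    \<Rightarrow> ('i \<Rightarrow> 'o) \<Rightarrow> ('i \<Rightarrow> 'i \<Rightarrow> 'm) \<Rightarrow> bool" where
  "direct_system C I R X \<phi> \<longleftrightarrow> directed_set I R \<and> X ` I \<subseteq> Ob C \<and>
    (\<forall>i\<in>I. \<forall>j\<in>I. R i j \<longrightarrow> \<phi> i j \<in> Hom C (X i) (X j)) \<and>
    (\<forall>i\<in>I. \<phi> i i = Idt C (X i)) \<and>
    (\<forall>i\<in>I. \<forall>j\<in>I. \<forall>k\<in>I. R i j \<longrightarrow> R j k \<longrightarrow> \<phi> j k \<cdot>\<^bsub>C\<^esub> \<phi> i j = \<phi> i k)"

definition system_morphism :: "('o, 'm) addcat \<Rightarrow> 'i set \<Rightarrow> ('i \<Rightarrow> 'i \<Rightarrow> bool)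
    \<Rightarrow> ('i \<Rightarrow> 'o) \<Rightarrow> ('i \<Rightarrow> 'i \<Rightarrow> 'm) \<Rightarrow> ('i \<Rightarrow> 'o) \<Rightarrow> ('i \<Rightarrow> 'i \<Rightarrow> 'm)
    \<Rightarrow> ('i \<Rightarrow> 'm) \<Rightarrow> bool" where
  "system_morphism C I R X \<phi> Y \<psi> f \<longleftrightarrow> (\<forall>i\<in>I. f i \<in> Hom C (X i) (Y i)) \<and>
    (\<forall>i\<in>I. \<forall>j\<in>I. R i j \<longrightarrow> f j \<cdot>\<^bsub>C\<^esub> \<phi> i j = \<psi> i j \<cdot>\<^bsub>C\<^esub> f i)"

definition is_cocone :: "('o, 'm) addcat \<Rightarrow> 'i set \<Rightarrow> ('i \<Rightarrow> 'i \<Rightarrow> bool)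
    \<Rightarrow> ('i \<Rightarrow> 'o) \<Rightarrow> ('i \<Rightarrow> 'i \<Rightarrow> 'm) \<Rightarrow> 'o \<Rightarrow> ('i \<Rightarrow> 'm) \<Rightarrow> bool" where
  "is_cocone C I R X \<phi> L l \<longleftrightarrow> L \<in> Ob C \<and> (\<forall>i\<in>I. l i \<in> Hom C (X i) L) \<and>
    (\<forall>i\<in>I. \<forall>j\<in>I. R i j \<longrightarrow> l j \<cdot>\<^bsub>C\<^esub> \<phi> i j = l i)"

definition is_direct_limit :: "('o, 'm) addcat \<Rightarrow> 'i set \<Rightarrow> ('i \<Rightarrow> 'i \<Rightarrow> bool)
    \<Rightarrow> ('i \<Rightarrow> 'o) \<Rightarrow> ('i \<Rightarrow> 'i \<Rightarrow> 'm) \<Rightarrow> 'o \<Rightarrow> ('i \<Rightarrow> 'm) \<Rightarrow> bool" where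
  "is_direct_limit C I R X \<phi> L l \<longleftrightarrow> is_cocone C I R X \<phi> L l \<and>
    (\<forall>T t. is_cocone C I R X \<phi> T t
      \<longrightarrow> (\<exists>!h. h \<in> Hom C L T \<and> (\<forall>i\<in>I. h \<cdot>\<^bsub>C\<^esub> l i = t i)))"


section \<open>Locally noetherian Grothendieck categories\<close>

definition generating :: "('o, 'm) addcat \<Rightarrow> 'o set \<Rightarrow> bool" where
  "generating C \<G> \<longleftrightarrow> \<G> \<subseteq> Ob C \<and>
    (\<forall>X Y. \<forall>f\<in>Hom C X Y. \<forall>g\<in>Hom C X Y. f \<noteq> g
      \<longrightarrow> (\<exists>G\<in>\<G>. \<exists>h\<in>Hom C G X. f \<cdot>\<^bsub>C\<^esub> h \<noteq> g \<cdot>\<^bsub>C\<^esub> h))"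

text \<open>
  Size convention: the infinite set \<open>U\<close> is an arbitrary bound on the size of small sets, and a small
  family is one indexed by a subset of \<open>U\<close>. Such a bound is unavoidable, since only the zero
  category has all coproducts indexed by its own set of morphisms.
  Direct limits need no existence axiom: they are cokernels of maps between coproducts.
\<close>

locale grothendieck_category = abelian_category C
  for C :: "('o, 'm) addcat" (structure) and U :: "'i set" +
  assumes infinite_U: "infinite U"
    and ex_coproduct: "\<And>I X. I \<subseteq> U \<Longrightarrow> X ` I \<subseteq> Ob C \<Longrightarrow> \<exists>S \<iota>. is_coproduct C I X S \<iota>"
    and exact_direct_limits:
      "\<And>I R X \<phi> Y \<psi> Z \<chi> f g L l M m N n u v.
        \<lbrakk> I \<subseteq> U;
          direct_system C I R X \<phi>; direct_system C I R Y \<psi>; direct_system C I R Z \<chi>;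
          system_morphism C I R X \<phi> Y \<psi> f; system_morphism C I R Y \<psi> Z \<chi> g;
          \<forall>i\<in>I. short_exact C (f i) (g i);
          is_direct_limit C I R X \<phi> L l; is_direct_limit C I R Y \<psi> M m;
          is_direct_limit C I R Z \<chi> N n;
          u \<in> Hom C L M; \<forall>i\<in>I. u \<cdot> l i = m i \<cdot> f i;
          v \<in> Hom C M N; \<forall>i\<in>I. v \<cdot> m i = n i \<cdot> g i \<rbrakk>
        \<Longrightarrow> short_exact C u v"
    and ex_generator: "\<exists>G. generating C {G}"

text \<open>
  Subobjects are represented by monomorphisms; \<open>subobject_le C m n\<close> says that \<open>m\<close> factors
  through \<open>n\<close>.
\<close>

definition subobject_le :: "('o, 'm) addcat \<Rightarrow> 'm \<Rightarrow> 'm \<Rightarrow> bool" where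
  "subobject_le C m n \<longleftrightarrow> (\<exists>h\<in>Hom C (Dom C m) (Dom C n). n \<cdot>\<^bsub>C\<^esub> h = m)"

definition noetherian_object :: "('o, 'm) addcat \<Rightarrow> 'o \<Rightarrow> bool" where
  "noetherian_object C X \<longleftrightarrow> X \<in> Ob C \<and>
    (\<forall>m :: nat \<Rightarrow> 'm.
      (\<forall>k. is_mono C (m k) \<and> Cod C (m k) = X \<and> subobject_le C (m k) (m (Suc k)))
      \<longrightarrow> (\<exists>n. \<forall>k\<ge>n. subobject_le C (m k) (m n)))"

locale locally_noetherian_grothendieck_category = grothendieck_category C U
  for C :: "('o, 'm) addcat" (structure) and U :: "'i set" +
  assumes noetherian_generators:
    "\<exists>I \<subseteq> U. \<exists>G. generating C (G ` I) \<and> (\<forall>i\<in>I. noetherian_object C (G i))"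


section \<open>The atom spectrum\<close>

text \<open>Below \<open>q\<close> ranges over the quotient maps \<open>H \<rightarrow> H/N\<close>, where \<open>N\<close> is the domain of \<open>n\<close>.\<close>

definition monoform :: "('o, 'm) addcat \<Rightarrow> 'o \<Rightarrow> bool" where
  "monoform C H \<longleftrightarrow> H \<in> Ob C \<and> \<not> is_zero_object C H \<and>
    (\<forall>n q. is_mono C n \<and> Cod C n = H \<and> \<not> is_zero_object C (Dom C n) \<and> is_cokernel C q n
      \<longrightarrow> \<not> (\<exists>s t. is_mono C s \<and> Cod C s = H \<and> \<not> is_zero_object C (Dom C s) \<and>
                 is_mono C t \<and> Cod C t = Cod C q \<and> isomorphic C (Dom C s) (Dom C t)))"

definition atom_equivalent :: "('o, 'm) addcat \<Rightarrow> 'o \<Rightarrow> 'o \<Rightarrow> bool" where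
  "atom_equivalent C H H' \<longleftrightarrow>
    (\<exists>s t. is_mono C s \<and> Cod C s = H \<and> \<not> is_zero_object C (Dom C s) \<and>
           is_mono C t \<and> Cod C t = H' \<and> \<not> is_zero_object C (Dom C t) \<and>
           isomorphic C (Dom C s) (Dom C t))"

definition atom_rel :: "('o, 'm) addcat \<Rightarrow> ('o \<times> 'o) set" where
  "atom_rel C = {(H, H'). monoform C H \<and> monoform C H' \<and> atom_equivalent C H H'}"

definition atom_of :: "('o, 'm) addcat \<Rightarrow> 'o \<Rightarrow> 'o set" where
  "atom_of C H = atom_rel C `` {H}"

definition ASpec :: "('o, 'm) addcat \<Rightarrow> 'o set set" where
  "ASpec C = Collect (monoform C) // atom_rel C"

text \<open>
  \<open>H\<close> is isomorphic to \<open>L/L'\<close> for subobjects \<open>L' \<subseteq> L \<subseteq> M\<close>, given by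
  \<open>l : L' \<rightarrow> L\<close> and \<open>m : L \<rightarrow> M\<close>.
\<close>

definition subquotient :: "('o, 'm) addcat \<Rightarrow> 'o \<Rightarrow> 'o \<Rightarrow> bool" where
  "subquotient C H M \<longleftrightarrow>
    (\<exists>m l q. is_mono C m \<and> Cod C m = M \<and> is_mono C l \<and> Cod C l = Dom C m \<and>
             is_cokernel C q l \<and> Cod C q = H)"

definition ASupp :: "('o, 'm) addcat \<Rightarrow> 'o \<Rightarrow> 'o set set" where
  "ASupp C M = {\<alpha> \<in> ASpec C. \<exists>H\<in>\<alpha>. subquotient C H M}"

definition ASpec_open :: "('o, 'm) addcat \<Rightarrow> 'o set set \<Rightarrow> bool" where
  "ASpec_open C \<Phi> \<longleftrightarrow> \<Phi> \<subseteq> ASpec C \<and> (\<forall>\<alpha>\<in>\<Phi>. \<exists>H\<in>\<alpha>. ASupp C H \<subseteq> \<Phi>)"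

definition ASpec_topology :: "('o, 'm) addcat \<Rightarrow> 'o set topology" where
  "ASpec_topology C = topology (ASpec_open C)"

definition specialization_le :: "'a topology \<Rightarrow> 'a \<Rightarrow> 'a \<Rightarrow> bool" where
  "specialization_le T a b \<longleftrightarrow> (\<forall>U. openin T U \<and> a \<in> U \<longrightarrow> b \<in> U)"

definition alexandroff_space :: "'a topology \<Rightarrow> bool" where
  "alexandroff_space T \<longleftrightarrow>
    (\<forall>\<U>. \<U> \<noteq> {} \<and> (\<forall>U\<in>\<U>. openin T U) \<longrightarrow> openin T (\<Inter>\<U>))"



section \<open>The open sets form a topology\<close>

lemma HomI: "f \<in> Ar C \<Longrightarrow> f \<in> Hom C (Dom C f) (Cod C f)"
  by (simp add: Hom_def)

lemma HomD: "f \<in> Hom C X Y \<Longrightarrow> f \<in> Ar C \<and> Dom C f = X \<and> Cod C f = Y"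
  by (simp add: Hom_def)

context category
begin

lemma Hom_Ob: "f \<in> Hom C X Y \<Longrightarrow> X \<in> Ob C \<and> Y \<in> Ob C"
  using Dom_Ob Cod_Ob by (auto simp: Hom_def)

lemma mono_cancel:
  "is_mono C f \<Longrightarrow> f \<in> Hom C Y Z \<Longrightarrow> g \<in> Hom C X Y \<Longrightarrow> h \<in> Hom C X Y \<Longrightarrow> f \<cdot> g = f \<cdot> h \<Longrightarrow> g = h"
  by (auto simp: is_mono_def Hom_def)

lemma epi_cancel:
  "is_epi C f \<Longrightarrow> f \<in> Hom C X Y \<Longrightarrow> g \<in> Hom C Y Z \<Longrightarrow> h \<in> Hom C Y Z \<Longrightarrow> g \<cdot> f = h \<cdot> f \<Longrightarrow> g = h"
  by (auto simp: is_epi_def Hom_def)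

lemma monoI:
  assumes "f \<in> Hom C Y Z"
    and "\<And>X g h. g \<in> Hom C X Y \<Longrightarrow> h \<in> Hom C X Y \<Longrightarrow> f \<cdot> g = f \<cdot> h \<Longrightarrow> g = h"
  shows "is_mono C f"
  using assms by (auto simp: is_mono_def Hom_def)

lemma epiI:
  assumes "f \<in> Hom C X Y"
    and "\<And>Z g h. g \<in> Hom C Y Z \<Longrightarrow> h \<in> Hom C Y Z \<Longrightarrow> g \<cdot> f = h \<cdot> f \<Longrightarrow> g = h"
  shows "is_epi C f"
  using assms by (auto simp: is_epi_def Hom_def)

lemma Idt_mono: "X \<in> Ob C \<Longrightarrow> is_mono C (Idt C X)"
  by (rule monoI[OF Idt_Hom]) (simp_all add: Idt_Comp)

lemma mono_comp:
  assumes "is_mono C f" "is_mono C g" "f \<in> Hom C X Y" "g \<in> Hom C Y Z"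
  shows "is_mono C (g \<cdot> f)"
proof (rule monoI)
  show "g \<cdot> f \<in> Hom C X Z" using assms Comp_Hom by blast
  fix W a b assume ab: "a \<in> Hom C W X" "b \<in> Hom C W X" "g \<cdot> f \<cdot> a = g \<cdot> f \<cdot> b"
  then have "g \<cdot> (f \<cdot> a) = g \<cdot> (f \<cdot> b)" using Comp_assoc assms by metis
  then have "f \<cdot> a = f \<cdot> b" using mono_cancel[OF assms(2,4)] Comp_Hom ab assms by blast
  then show "a = b" using mono_cancel[OF assms(1,3)] ab by blast
qed

lemma mono_factor:
  assumes "is_mono C (g \<cdot> f)" "f \<in> Hom C X Y" "g \<in> Hom C Y Z"
  shows "is_mono C f"
proof (rule monoI[OF assms(2)])
  fix W a b assume ab: "a \<in> Hom C W X" "b \<in> Hom C W X" "f \<cdot> a = f \<cdot> b"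
  then have "g \<cdot> f \<cdot> a = g \<cdot> f \<cdot> b" using Comp_assoc assms by metis
  then show "a = b" using mono_cancel[OF assms(1) Comp_Hom[OF assms(2,3)]] ab by blast
qed

lemma isomorphic_mono:
  assumes "isomorphic C X Y" obtains f where "f \<in> Hom C X Y" "is_mono C f"
proof -
  obtain f g where fg: "f \<in> Hom C X Y" "g \<in> Hom C Y X" "g \<cdot> f = Idt C X" "X \<in> Ob C"
    using assms by (auto simp: isomorphic_def)
  then have "is_mono C f" using mono_factor[of g f] Idt_mono by metis
  with fg that show ?thesis by blast
qed

lemma isomorphic_refl: "X \<in> Ob C \<Longrightarrow> isomorphic C X X"
  using Idt_Hom Idt_Comp by (fastforce simp: isomorphic_def)

lemma isomorphic_sym: "isomorphic C X Y \<Longrightarrow> isomorphic C Y X"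
  by (auto simp: isomorphic_def)

lemma atom_equivalent_iff:
  "atom_equivalent C H H' \<longleftrightarrow> (\<exists>L s t. \<not> is_zero_object C L \<and> s \<in> Hom C L H \<and> is_mono C s \<and>
     t \<in> Hom C L H' \<and> is_mono C t)"
proof
  assume "atom_equivalent C H H'"
  then obtain s t where st: "is_mono C s" "Cod C s = H" "\<not> is_zero_object C (Dom C s)"
    "is_mono C t" "Cod C t = H'" "isomorphic C (Dom C s) (Dom C t)"
    by (auto simp: atom_equivalent_def)
  obtain f where f: "f \<in> Hom C (Dom C s) (Dom C t)" "is_mono C f"
    using isomorphic_mono[OF st(6)] .
  have s: "s \<in> Hom C (Dom C s) H" and t: "t \<in> Hom C (Dom C t) H'"
    using st by (auto simp: is_mono_def Hom_def)
  have "t \<cdot> f \<in> Hom C (Dom C s) H'" "is_mono C (t \<cdot> f)"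
    using Comp_Hom[OF f(1) t] mono_comp[OF f(2) st(4) f(1) t] by auto
  with st(1,3) s show "\<exists>L s t. \<not> is_zero_object C L \<and> s \<in> Hom C L H \<and> is_mono C s \<and>
     t \<in> Hom C L H' \<and> is_mono C t" by blast
next
  assume "\<exists>L s t. \<not> is_zero_object C L \<and> s \<in> Hom C L H \<and> is_mono C s \<and>
     t \<in> Hom C L H' \<and> is_mono C t"
  then obtain L s t where st: "\<not> is_zero_object C L" "s \<in> Hom C L H" "is_mono C s"
     "t \<in> Hom C L H'" "is_mono C t" by blast
  have "isomorphic C L L" using isomorphic_refl Hom_Ob st by blast
  with st show "atom_equivalent C H H'"
    unfolding atom_equivalent_def by (intro exI[of _ s] exI[of _ t]) (auto simp: Hom_def)
qed

end

context preadditive_category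
begin

lemma Zer_Hom: "X \<in> Ob C \<Longrightarrow> Y \<in> Ob C \<Longrightarrow> Zer C X Y \<in> Hom C X Y"
  using Hom_group[THEN comm_group.axioms(1), THEN comm_monoid.axioms(1), THEN monoid.one_closed]
  by auto

lemma idem_Zer: "f \<in> Hom C X Y \<Longrightarrow> f \<oplus> f = f \<Longrightarrow> f = Zer C X Y"
  using Hom_group[of X Y, THEN comm_group.axioms(2)] group.r_cancel_one[of "\<lparr>carrier = Hom C X Y, monoid.mult = Plus C, one = Zer C X Y\<rparr>" f f]
  using Hom_Ob by fastforce

lemma Zer_Plus: "X \<in> Ob C \<Longrightarrow> Y \<in> Ob C \<Longrightarrow> Zer C X Y \<oplus> Zer C X Y = Zer C X Y"
  using Hom_group[of X Y, THEN comm_group.axioms(1), THEN comm_monoid.axioms(1)]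
    monoid.l_one Zer_Hom by fastforce

lemma Comp_Zer:
  assumes "g \<in> Hom C Y Z" "X \<in> Ob C" shows "g \<cdot> Zer C X Y = Zer C X Z"
proof -
  have z: "Zer C X Y \<in> Hom C X Y" "Zer C X Y \<oplus> Zer C X Y = Zer C X Y"
    using Zer_Hom Zer_Plus Hom_Ob assms by blast+
  show ?thesis using idem_Zer[OF Comp_Hom[OF z(1) assms(1)]] Comp_Plus_right[OF z(1) z(1) assms(1)] z(2) by metis
qed

lemma Zer_Comp:
  assumes "f \<in> Hom C X Y" "Z \<in> Ob C" shows "Zer C Y Z \<cdot> f = Zer C X Z"
proof -
  have z: "Zer C Y Z \<in> Hom C Y Z" "Zer C Y Z \<oplus> Zer C Y Z = Zer C Y Z"
    using Zer_Hom Zer_Plus Hom_Ob assms by blast+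
  show ?thesis using idem_Zer[OF Comp_Hom[OF assms(1) z(1)]] Comp_Plus_left[OF assms(1) z(1) z(1)] z(2) by metis
qed

lemma Minus_ex:
  assumes "f \<in> Hom C X Y"
  obtains f' where "f' \<in> Hom C X Y" "f \<oplus> f' = Zer C X Y"
proof -
  have "group \<lparr>carrier = Hom C X Y, monoid.mult = Plus C, one = Zer C X Y\<rparr>"
    using Hom_group comm_group.axioms(2) Hom_Ob assms by blast
  from group.inv_closed[OF this] group.r_inv[OF this] show ?thesis using assms that by fastforce
qed

lemma Minus_unique:
  assumes "f \<in> Hom C X Y" "g \<in> Hom C X Y" "f' \<in> Hom C X Y" "f \<oplus> f' = Zer C X Y" "g \<oplus> f' = Zer C X Y"
  shows "f = g"
proof -
  have "group \<lparr>carrier = Hom C X Y, monoid.mult = Plus C, one = Zer C X Y\<rparr>"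
    using Hom_group comm_group.axioms(2) Hom_Ob assms(1) by blast
  from group.right_cancel[OF this, of f' f g] show ?thesis using assms by simp
qed

lemma Plus_Hom:
  assumes "f \<in> Hom C X Y" "g \<in> Hom C X Y" shows "f \<oplus> g \<in> Hom C X Y"
proof -
  have "monoid \<lparr>carrier = Hom C X Y, monoid.mult = Plus C, one = Zer C X Y\<rparr>"
    using Hom_group comm_group.axioms(1) comm_monoid.axioms(1) Hom_Ob assms(1) by blast
  from monoid.m_closed[OF this, of f g] show ?thesis using assms by simp
qed

lemma monoI0:
  assumes f: "f \<in> Hom C Y Z"
    and k: "\<And>X g. g \<in> Hom C X Y \<Longrightarrow> f \<cdot> g = Zer C X Z \<Longrightarrow> g = Zer C X Y"
  shows "is_mono C f"
proof (rule monoI[OF f])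
  fix X g h assume gh: "g \<in> Hom C X Y" "h \<in> Hom C X Y" "f \<cdot> g = f \<cdot> h"
  obtain h' where h': "h' \<in> Hom C X Y" "h \<oplus> h' = Zer C X Y" using Minus_ex gh(2) .
  have "f \<cdot> (g \<oplus> h') = f \<cdot> (h \<oplus> h')"
    using Comp_Plus_right[OF gh(1) h'(1) f] Comp_Plus_right[OF gh(2) h'(1) f] gh(3) by simp
  then have "g \<oplus> h' = Zer C X Y"
    using k[OF Plus_Hom[OF gh(1) h'(1)]] h' Comp_Zer f Hom_Ob gh(1) by metis
  then show "g = h" using Minus_unique[OF gh(1,2) h'(1)] h'(2) by simp
qed

lemma zero_objectI:
  assumes "X \<in> Ob C" "Idt C X = Zer C X X" shows "is_zero_object C X"
  unfolding is_zero_object_def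
proof (intro conjI ballI)
  fix Y assume Y: "Y \<in> Ob C"
  have "f = Zer C X Y" if "f \<in> Hom C X Y" for f
    using that assms Comp_Zer Comp_Idt by metis
  then show "\<exists>!f. f \<in> Hom C X Y" using Zer_Hom[OF assms(1) Y] by blast
  have "f = Zer C Y X" if "f \<in> Hom C Y X" for f
    using that assms Zer_Comp Idt_Comp by metis
  then show "\<exists>!f. f \<in> Hom C Y X" using Zer_Hom[OF Y assms(1)] by blast
qed (fact assms)

lemma zero_object_Hom:
  assumes "is_zero_object C X" "f \<in> Hom C Y X" shows "f = Zer C Y X"
proof -
  have Y: "Y \<in> Ob C" and X: "X \<in> Ob C" using Hom_Ob[OF assms(2)] by auto
  then have "\<exists>!f. f \<in> Hom C Y X" using assms(1) by (simp add: is_zero_object_def)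
  then show ?thesis using assms(2) Zer_Hom[OF Y X] by (elim ex1E) metis
qed

lemma zero_object_mono:
  assumes "is_zero_object C X" "f \<in> Hom C Y X" "is_mono C f" shows "is_zero_object C Y"
proof (rule zero_objectI)
  show Y: "Y \<in> Ob C" using Hom_Ob assms by blast
  show "Idt C Y = Zer C Y Y"
    using mono_cancel[OF assms(3,2) Idt_Hom[OF Y] Zer_Hom[OF Y Y]] assms(2)
      zero_object_Hom[OF assms(1)] Comp_Hom Idt_Hom[OF Y] Zer_Hom[OF Y Y] by metis
qed

lemma kernelD:
  assumes "is_kernel C k f" "f \<in> Hom C Y Z" "k \<in> Hom C K Y"
  shows "f \<cdot> k = Zer C K Z" "is_mono C k"
    and "\<And>X g. g \<in> Hom C X Y \<Longrightarrow> f \<cdot> g = Zer C X Z \<Longrightarrow> \<exists>h \<in> Hom C X K. k \<cdot> h = g"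
proof -
  have dk: "Dom C f = Y" "Cod C f = Z" "Dom C k = K" using assms(2,3) by (auto dest: HomD)
  have k: "f \<cdot> k = Zer C K Z"
    "\<And>X g. g \<in> Hom C X Y \<Longrightarrow> f \<cdot> g = Zer C X Z \<Longrightarrow> \<exists>!h. h \<in> Hom C X K \<and> k \<cdot> h = g"
    using assms(1) unfolding is_kernel_def dk by simp_all
  show 1: "f \<cdot> k = Zer C K Z" by (fact k(1))
  show "\<exists>h \<in> Hom C X K. k \<cdot> h = g" if "g \<in> Hom C X Y" "f \<cdot> g = Zer C X Z" for X g
    using k(2)[OF that] by blast
  show "is_mono C k"
  proof (rule monoI[OF assms(3)])
    fix X g h assume gh: "g \<in> Hom C X K" "h \<in> Hom C X K" "k \<cdot> g = k \<cdot> h"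
    have "f \<cdot> (k \<cdot> g) = Zer C X Z"
      using Comp_assoc[OF gh(1) assms(3,2)] 1 Zer_Comp[OF gh(1)] Hom_Ob assms(2) by metis
    moreover have "k \<cdot> g \<in> Hom C X Y" using Comp_Hom gh assms by blast
    ultimately have "\<exists>!h. h \<in> Hom C X K \<and> k \<cdot> h = k \<cdot> g" using k(2) by blast
    then show "g = h" using gh by metis
  qed
qed

lemma cokernelD:
  assumes "is_cokernel C q f" "f \<in> Hom C X Y" "q \<in> Hom C Y Q"
  shows "q \<cdot> f = Zer C X Q" "is_epi C q"
    and "\<And>Z g. g \<in> Hom C Y Z \<Longrightarrow> g \<cdot> f = Zer C X Z \<Longrightarrow> \<exists>h \<in> Hom C Q Z. h \<cdot> q = g"
proof -
  have dq: "Dom C f = X" "Cod C f = Y" "Cod C q = Q" using assms(2,3) by (auto dest: HomD)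
  have k: "q \<cdot> f = Zer C X Q"
    "\<And>Z g. g \<in> Hom C Y Z \<Longrightarrow> g \<cdot> f = Zer C X Z \<Longrightarrow> \<exists>!h. h \<in> Hom C Q Z \<and> h \<cdot> q = g"
    using assms(1) unfolding is_cokernel_def dq by simp_all
  show 1: "q \<cdot> f = Zer C X Q" by (fact k(1))
  show "\<exists>h \<in> Hom C Q Z. h \<cdot> q = g" if "g \<in> Hom C Y Z" "g \<cdot> f = Zer C X Z" for Z g
    using k(2)[OF that] by blast
  show "is_epi C q"
  proof (rule epiI[OF assms(3)])
    fix Z g h assume gh: "g \<in> Hom C Q Z" "h \<in> Hom C Q Z" "g \<cdot> q = h \<cdot> q"
    have "(g \<cdot> q) \<cdot> f = Zer C X Z"
      using Comp_assoc[OF assms(2,3) gh(1)] 1 Comp_Zer[OF gh(1)] Hom_Ob assms(2) by metis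
    moreover have "g \<cdot> q \<in> Hom C Y Z" using Comp_Hom gh assms by blast
    ultimately have "\<exists>!h. h \<in> Hom C Q Z \<and> h \<cdot> q = g \<cdot> q" using k(2) by blast
    then show "g = h" using gh by metis
  qed
qed

end

context abelian_category
begin

lemma kernel_obtain:
  assumes "f \<in> Hom C Y Z" obtains K k where "is_kernel C k f" "k \<in> Hom C K Y"
  using ex_kernel[of f] HomD[OF assms] that by (auto simp: is_kernel_def Hom_def)

lemma cokernel_obtain:
  assumes "f \<in> Hom C X Y" obtains Q q where "is_cokernel C q f" "q \<in> Hom C Y Q"
  using ex_cokernel[of f] HomD[OF assms] that by (auto simp: is_cokernel_def Hom_def)

lemma epi_comp:
  assumes "is_epi C f" "is_epi C g" "f \<in> Hom C X Y" "g \<in> Hom C Y Z"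
  shows "is_epi C (g \<cdot> f)"
proof (rule epiI)
  show "g \<cdot> f \<in> Hom C X Z" using assms Comp_Hom by blast
  fix W a b assume ab: "a \<in> Hom C Z W" "b \<in> Hom C Z W" "a \<cdot> (g \<cdot> f) = b \<cdot> (g \<cdot> f)"
  then have "(a \<cdot> g) \<cdot> f = (b \<cdot> g) \<cdot> f" using Comp_assoc assms by metis
  then have "a \<cdot> g = b \<cdot> g" using epi_cancel[OF assms(1,3)] Comp_Hom ab assms by blast
  then show "a = b" using epi_cancel[OF assms(2,4)] ab by blast
qed

lemma mono_kernel_cokernel:
  assumes n: "is_mono C n" "n \<in> Hom C N H" and q: "is_cokernel C q n" "q \<in> Hom C H Q"
    and g: "g \<in> Hom C X H" "q \<cdot> g = Zer C X Q"
  obtains h where "h \<in> Hom C X N" "n \<cdot> h = g"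
proof -
  obtain p where p: "is_kernel C n p" using mono_is_kernel n(1) by blast
  then obtain P where pP: "p \<in> Hom C H P" using n(2) by (auto simp: is_kernel_def Hom_def)
  note k = kernelD[OF p pP n(2)]
  note c = cokernelD[OF q(1) n(2) q(2)]
  obtain u where u: "u \<in> Hom C Q P" "u \<cdot> q = p" using c(3)[OF pP k(1)] by blast
  have "p \<cdot> g = Zer C X P" using u g q Comp_assoc Comp_Zer Hom_Ob by metis
  then show ?thesis using k(3)[OF g(1)] that by blast
qed

lemma epi_cokernel_of:
  assumes "is_epi C f" "f \<in> Hom C X Y"
  obtains W w where "is_cokernel C f w" "w \<in> Hom C W X"
  using epi_is_cokernel[OF assms(1)] assms(2) that by (auto simp: is_cokernel_def Hom_def)

lemma coimage_mono:
  assumes f: "f \<in> Hom C Y Z" and n: "n \<in> Hom C N Y" and q: "is_cokernel C q n" "q \<in> Hom C Y Q"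
    and t: "t \<in> Hom C Q Z" "t \<cdot> q = f"
    and ker: "\<And>X g. g \<in> Hom C X Y \<Longrightarrow> f \<cdot> g = Zer C X Z \<Longrightarrow> \<exists>h \<in> Hom C X N. n \<cdot> h = g"
  shows "is_mono C t"
proof (rule monoI0[OF t(1)])
  fix X x assume x: "x \<in> Hom C X Q" "t \<cdot> x = Zer C X Z"
  note qD = cokernelD[OF q(1) n q(2)]
  obtain D c where c: "is_cokernel C c x" "c \<in> Hom C Q D" using cokernel_obtain x(1) .
  note cD = cokernelD[OF c(1) x(1) c(2)]
  obtain t' where t': "t' \<in> Hom C D Z" "t' \<cdot> c = t" using cD(3)[OF t(1) x(2)] by blast
  have cq: "is_epi C (c \<cdot> q)" "c \<cdot> q \<in> Hom C Y D"
    using epi_comp[OF qD(2) cD(2) q(2) c(2)] Comp_Hom[OF q(2) c(2)] by auto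
  obtain W w where w: "is_cokernel C (c \<cdot> q) w" "w \<in> Hom C W Y" using epi_cokernel_of cq .
  note wD = cokernelD[OF w(1) w(2) cq(2)]
  have "f = t' \<cdot> (c \<cdot> q)" using t t' c q Comp_assoc by metis
  then have "f \<cdot> w = Zer C W Z"
    using Comp_assoc[OF w(2) cq(2) t'(1)] wD(1) Comp_Zer t'(1) Hom_Ob w(2) by metis
  then obtain z where z: "z \<in> Hom C W N" "n \<cdot> z = w" using ker[OF w(2)] by blast
  have "q \<cdot> w = Zer C W Q"
    using z q(2) n Comp_assoc[OF z(1) n q(2)] qD(1) Zer_Comp[OF z(1)] Hom_Ob by metis
  then obtain s where s: "s \<in> Hom C D Q" "s \<cdot> (c \<cdot> q) = q" using wD(3)[OF q(2)] by blast
  have Q: "Q \<in> Ob C" using Hom_Ob q by blast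
  have "(s \<cdot> c) \<cdot> q = Idt C Q \<cdot> q" using s q(2) c(2) Comp_assoc Idt_Comp by metis
  then have sc: "s \<cdot> c = Idt C Q"
    using epi_cancel[OF qD(2) q(2) Comp_Hom[OF c(2) s(1)] Idt_Hom[OF Q]] by blast
  have "x = (s \<cdot> c) \<cdot> x" using sc Idt_Comp x by metis
  also have "\<dots> = s \<cdot> (c \<cdot> x)" using Comp_assoc[OF x(1) c(2) s(1)] .
  also have "\<dots> = Zer C X Q" using cD(1) Comp_Zer[OF s(1)] Hom_Ob x(1) by metis
  finally show "x = Zer C X Q" .
qed

lemma monoformD:
  assumes "monoform C H" "n \<in> Hom C N H" "is_mono C n" "\<not> is_zero_object C N"
    "is_cokernel C q n" "q \<in> Hom C H Q"
    "s \<in> Hom C K H" "is_mono C s" "\<not> is_zero_object C K" "t \<in> Hom C K Q" "is_mono C t"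
  shows False
proof -
  have K: "isomorphic C K K" using isomorphic_refl Hom_Ob assms(7) by blast
  have d: "Dom C n = N" "Cod C n = H" "Cod C q = Q" "Dom C s = K" "Cod C s = H" "Dom C t = K" "Cod C t = Q"
    using assms(2,6,7,10) by (auto dest: HomD)
  have "\<not> (\<exists>s t. is_mono C s \<and> Cod C s = H \<and> \<not> is_zero_object C (Dom C s) \<and>
                 is_mono C t \<and> Cod C t = Cod C q \<and> isomorphic C (Dom C s) (Dom C t))"
    using assms(1)[unfolded monoform_def, THEN conjunct2, THEN conjunct2, rule_format, of n q]
      assms(3-5) d by blast
  then show False using assms(8,9,11) d K by metis
qed

lemma monoform_uniform:
  assumes H: "monoform C H" and n: "n \<in> Hom C N H" "is_mono C n" "\<not> is_zero_object C N"
    and k: "k \<in> Hom C K H" "is_mono C k" "\<not> is_zero_object C K"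
  obtains L a b where "\<not> is_zero_object C L" "a \<in> Hom C L N" "is_mono C a"
    "b \<in> Hom C L K" "is_mono C b" "n \<cdot> a = k \<cdot> b"
proof -
  obtain Q q where q: "is_cokernel C q n" "q \<in> Hom C H Q" using cokernel_obtain n(1) .
  have qk: "q \<cdot> k \<in> Hom C K Q" using Comp_Hom k q by blast
  obtain L b where b: "is_kernel C b (q \<cdot> k)" "b \<in> Hom C L K" using kernel_obtain qk .
  note bD = kernelD[OF b(1) qk b(2)]
  have kb: "k \<cdot> b \<in> Hom C L H" "is_mono C (k \<cdot> b)"
    using Comp_Hom[OF b(2) k(1)] mono_comp[OF bD(2) k(2) b(2) k(1)] by auto
  have "q \<cdot> (k \<cdot> b) = Zer C L Q" using bD(1) Comp_assoc b k q by metis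
  then obtain a where a: "a \<in> Hom C L N" "n \<cdot> a = k \<cdot> b"
    using mono_kernel_cokernel[OF n(2,1) q kb(1)] by blast
  have "\<not> is_zero_object C L"
  proof
    assume L: "is_zero_object C L"
    have "is_mono C (q \<cdot> k)"
    proof (rule monoI0[OF qk])
      fix X g assume g: "g \<in> Hom C X K" "q \<cdot> k \<cdot> g = Zer C X Q"
      then obtain h where h: "h \<in> Hom C X L" "b \<cdot> h = g" using bD(3) by blast
      then show "g = Zer C X K" using zero_object_Hom[OF L h(1)] Comp_Zer b(2) Hom_Ob by metis
    qed
    then show False using monoformD[OF H n q k qk] by blast
  qed
  then show ?thesis using that[of L a b] a b bD(2) kb(2) mono_factor[of n a] n(1) by metis
qed

lemma monoform_subobject:
  assumes H: "monoform C H" and l: "l \<in> Hom C L H" "is_mono C l" "\<not> is_zero_object C L"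
  shows "monoform C L"
  unfolding monoform_def
proof (intro conjI allI impI)
  show "L \<in> Ob C" using Hom_Ob l by blast
  show "\<not> is_zero_object C L" by fact
  fix n q
  assume "is_mono C n \<and> Cod C n = L \<and> \<not> is_zero_object C (Dom C n) \<and> is_cokernel C q n"
  then have n: "n \<in> Hom C (Dom C n) L" "is_mono C n" "\<not> is_zero_object C (Dom C n)"
    and q: "is_cokernel C q n" "q \<in> Hom C L (Cod C q)"
    by (auto simp: is_mono_def is_cokernel_def Hom_def)
  define N Q where "N = Dom C n" and "Q = Cod C q"
  note n = n[folded N_def Q_def] and q = q[folded N_def Q_def]
  show "\<not> (\<exists>s t. is_mono C s \<and> Cod C s = L \<and> \<not> is_zero_object C (Dom C s) \<and>
          is_mono C t \<and> Cod C t = Cod C q \<and> isomorphic C (Dom C s) (Dom C t))"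
  proof
    assume "\<exists>s t. is_mono C s \<and> Cod C s = L \<and> \<not> is_zero_object C (Dom C s) \<and>
          is_mono C t \<and> Cod C t = Cod C q \<and> isomorphic C (Dom C s) (Dom C t)"
    then obtain s t where st: "is_mono C s" "Cod C s = L" "\<not> is_zero_object C (Dom C s)"
      "is_mono C t" "Cod C t = Cod C q" "isomorphic C (Dom C s) (Dom C t)" by blast
    then have s: "s \<in> Hom C (Dom C s) L" and t: "t \<in> Hom C (Dom C t) Q"
      by (auto simp: is_mono_def Hom_def Q_def)
    obtain i where i: "i \<in> Hom C (Dom C s) (Dom C t)" "is_mono C i"
      using isomorphic_mono[OF st(6)] .
    have ln: "l \<cdot> n \<in> Hom C N H" "is_mono C (l \<cdot> n)"
      using Comp_Hom[OF n(1) l(1)] mono_comp[OF n(2) l(2) n(1) l(1)] by auto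
    obtain P p where p: "is_cokernel C p (l \<cdot> n)" "p \<in> Hom C H P" using cokernel_obtain ln(1) .
    have pl: "p \<cdot> l \<in> Hom C L P" using Comp_Hom l p by blast
    have "(p \<cdot> l) \<cdot> n = Zer C N P"
      using cokernelD(1)[OF p(1) ln(1) p(2)] Comp_assoc n l p by metis
    then obtain v where v: "v \<in> Hom C Q P" "v \<cdot> q = p \<cdot> l"
      using cokernelD(3)[OF q(1) n(1) q(2) pl] by blast
    have "is_mono C v"
    proof (rule coimage_mono[OF pl n(1) q v])
      fix X g assume g: "g \<in> Hom C X L" "p \<cdot> l \<cdot> g = Zer C X P"
      have "p \<cdot> (l \<cdot> g) = Zer C X P" using Comp_assoc g l p by metis
      then obtain h where h: "h \<in> Hom C X N" "l \<cdot> n \<cdot> h = l \<cdot> g"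
        using mono_kernel_cokernel[OF ln(2,1) p Comp_Hom[OF g(1) l(1)]] by blast
      then have "l \<cdot> (n \<cdot> h) = l \<cdot> g" using Comp_assoc n l by metis
      then show "\<exists>h \<in> Hom C X N. n \<cdot> h = g"
        using mono_cancel[OF l(2,1) Comp_Hom[OF h(1) n(1)] g(1)] h by blast
    qed
    then have "is_mono C (v \<cdot> (t \<cdot> i))" "v \<cdot> (t \<cdot> i) \<in> Hom C (Dom C s) P"
      using mono_comp Comp_Hom i st(4) t v(1) by metis+
    moreover have "is_mono C (l \<cdot> s)" "l \<cdot> s \<in> Hom C (Dom C s) H"
      using mono_comp Comp_Hom s st(1) l by metis+
    ultimately show False using monoformD[OF H ln n(3) p] st(3) by blast
  qed
qed

lemma atom_equivalent_trans:
  assumes "monoform C H'" "atom_equivalent C H H'" "atom_equivalent C H' H''"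
  shows "atom_equivalent C H H''"
proof -
  obtain L s t where st: "\<not> is_zero_object C L" "s \<in> Hom C L H" "is_mono C s"
    "t \<in> Hom C L H'" "is_mono C t" using assms(2) unfolding atom_equivalent_iff by blast
  obtain K u v where uv: "\<not> is_zero_object C K" "u \<in> Hom C K H'" "is_mono C u"
    "v \<in> Hom C K H''" "is_mono C v" using assms(3) unfolding atom_equivalent_iff by blast
  obtain M a b where ab: "\<not> is_zero_object C M" "a \<in> Hom C M L" "is_mono C a"
    "b \<in> Hom C M K" "is_mono C b"
    using monoform_uniform[OF assms(1) st(4,5,1) uv(2,3,1)] by metis
  have "s \<cdot> a \<in> Hom C M H" "is_mono C (s \<cdot> a)" "v \<cdot> b \<in> Hom C M H''" "is_mono C (v \<cdot> b)"
    using Comp_Hom[OF ab(2) st(2)] mono_comp[OF ab(3) st(3) ab(2) st(2)]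
      Comp_Hom[OF ab(4) uv(4)] mono_comp[OF ab(5) uv(5) ab(4) uv(4)] by auto
  with ab(1) show ?thesis unfolding atom_equivalent_iff by blast
qed

lemma atom_rel_equiv: "equiv (Collect (monoform C)) (atom_rel C)"
proof (rule equivI)
  show "atom_rel C \<subseteq> Collect (monoform C) \<times> Collect (monoform C)" by (auto simp: atom_rel_def)
  show "refl_on (Collect (monoform C)) (atom_rel C)"
  proof (rule refl_onI)
    fix H assume "H \<in> Collect (monoform C)"
    then have H: "monoform C H" "H \<in> Ob C" "\<not> is_zero_object C H" by (auto simp: monoform_def)
    then have "atom_equivalent C H H"
      unfolding atom_equivalent_iff using Idt_Hom Idt_mono by blast
    then show "(H, H) \<in> atom_rel C" using H by (simp add: atom_rel_def)
  qed
  show "sym (atom_rel C)"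
    unfolding sym_def atom_rel_def atom_equivalent_iff by blast
  show "trans (atom_rel C)"
    by (rule transI) (auto simp: atom_rel_def intro: atom_equivalent_trans)
qed

lemma ASupp_subobject:
  assumes "l \<in> Hom C L H" "is_mono C l" shows "ASupp C L \<subseteq> ASupp C H"
proof
  fix \<alpha> assume "\<alpha> \<in> ASupp C L"
  then obtain K m n q where \<alpha>: "\<alpha> \<in> ASpec C" "K \<in> \<alpha>"
    and m: "is_mono C m" "m \<in> Hom C (Dom C m) L"
    and n: "is_mono C n" "Cod C n = Dom C m" "is_cokernel C q n" "Cod C q = K"
    by (auto simp: ASupp_def subquotient_def is_mono_def Hom_def)
  have "is_mono C (l \<cdot> m)" "l \<cdot> m \<in> Hom C (Dom C m) H"
    using mono_comp[OF m(1) assms(2) m(2) assms(1)] Comp_Hom[OF m(2) assms(1)] by auto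
  then have "subquotient C K H"
    unfolding subquotient_def using n by (metis HomD)
  with \<alpha> show "\<alpha> \<in> ASupp C H" by (auto simp: ASupp_def)
qed

lemma istopology_ASpec_open: "istopology (ASpec_open C)"
  unfolding istopology_def
proof (intro conjI allI impI)
  fix S T assume ST: "ASpec_open C S" "ASpec_open C T"
  show "ASpec_open C (S \<inter> T)" unfolding ASpec_open_def
  proof (intro conjI ballI)
    show "S \<inter> T \<subseteq> ASpec C" using ST by (auto simp: ASpec_open_def)
    fix \<alpha> assume \<alpha>: "\<alpha> \<in> S \<inter> T"
    then obtain H H' where H: "H \<in> \<alpha>" "ASupp C H \<subseteq> S" "H' \<in> \<alpha>" "ASupp C H' \<subseteq> T"
      using ST unfolding ASpec_open_def by (meson IntE)
    have \<alpha>': "\<alpha> \<in> Collect (monoform C) // atom_rel C"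
      using ST \<alpha> by (auto simp: ASpec_open_def ASpec_def)
    have HH': "(H, H') \<in> atom_rel C"
      using quotient_eq_iff[OF atom_rel_equiv \<alpha>' \<alpha>' H(1,3)] by simp
    then have mH: "monoform C H" and "atom_equivalent C H H'" by (auto simp: atom_rel_def)
    then obtain L s t where L: "\<not> is_zero_object C L" "s \<in> Hom C L H" "is_mono C s"
        "t \<in> Hom C L H'" "is_mono C t"
      unfolding atom_equivalent_iff by blast
    have mL: "monoform C L" by (rule monoform_subobject[OF mH L(2,3,1)])
    then have "L \<in> Ob C" by (simp add: monoform_def)
    then have "atom_equivalent C H L"
      unfolding atom_equivalent_iff using Idt_Hom Idt_mono L(1-3) by blast
    then have "(H, L) \<in> atom_rel C" using mL mH by (simp add: atom_rel_def)
    then have "L \<in> \<alpha>" using in_quotient_imp_closed[OF atom_rel_equiv \<alpha>' H(1)] by blast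
    moreover have "ASupp C L \<subseteq> S \<inter> T"
      using ASupp_subobject[OF L(2,3)] ASupp_subobject[OF L(4,5)] H(2,4) by blast
    ultimately show "\<exists>L\<in>\<alpha>. ASupp C L \<subseteq> S \<inter> T" by blast
  qed
next
  fix \<K> assume K: "\<forall>K\<in>\<K>. ASpec_open C K"
  show "ASpec_open C (\<Union>\<K>)" unfolding ASpec_open_def
  proof (intro conjI ballI)
    show "\<Union>\<K> \<subseteq> ASpec C" using K by (auto simp: ASpec_open_def)
    fix \<alpha> assume "\<alpha> \<in> \<Union>\<K>"
    then obtain S where S: "S \<in> \<K>" "\<alpha> \<in> S" by blast
    then obtain H where "H \<in> \<alpha>" "ASupp C H \<subseteq> S" using K unfolding ASpec_open_def by meson
    then show "\<exists>H\<in>\<alpha>. ASupp C H \<subseteq> \<Union>\<K>" using S by blast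
  qed
qed

lemma openin_ASpec_topology: "openin (ASpec_topology C) = ASpec_open C"
  by (simp add: ASpec_topology_def istopology_ASpec_open)

end

end

theory Submission
  imports Defs
begin

text \<open>
  Supports of objects are open, because subquotients of subquotients are subquotients. In an
  Alexandroff space the up-set of \<open>\<alpha>\<close> is open, so it contains \<open>ASupp H'\<close> for some \<open>H'\<close>
  in \<open>\<alpha>\<close>. A common nonzero subobject \<open>H\<^sub>1\<close> of \<open>H\<close> and \<open>H'\<close> has support contained in that
  up-set, and its support is an open set containing \<open>\<alpha>\<close>, hence contains the up-set.
\<close>

context abelian_category
begin

text \<open>As an epimorphism, \<open>f\<close> is the cokernel of some \<open>w\<close>. That
  \<open>w\<close> factors through the kernel \<open>k\<close>, so every map that kills
  \<open>k\<close> kills \<open>w\<close> and hence factors through \<open>f\<close>.\<close>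

lemma epi_cokernel_of_kernel:
  assumes f: "is_epi C f" "f \<in> Hom C Y Z" and k: "is_kernel C k f" "k \<in> Hom C K Y"
  shows "is_cokernel C f k"
proof -
  obtain W w where w: "is_cokernel C f w" "w \<in> Hom C W Y" using epi_cokernel_of f .
  note wD = cokernelD[OF w f(2)]
  note kD = kernelD[OF k(1) f(2) k(2)]
  obtain w' where w': "w' \<in> Hom C W K" "k \<cdot> w' = w" using kD(3)[OF w(2) wD(1)] by blast
  have d: "f \<in> Ar C" "Dom C f = Y" "Cod C f = Z" "k \<in> Ar C" "Dom C k = K" "Cod C k = Y"
    using HomD[OF f(2)] HomD[OF k(2)] by simp_all
  have "\<exists>!h. h \<in> Hom C Z X \<and> h \<cdot> f = g" if g: "g \<in> Hom C Y X" "g \<cdot> k = Zer C K X" for X g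
  proof -
    have "X \<in> Ob C" using Hom_Ob g(1) by blast
    then have "g \<cdot> w = Zer C W X"
      using Comp_assoc[OF w'(1) k(2) g(1)] w'(2) g(2) Zer_Comp[OF w'(1)] by simp
    then obtain h where h: "h \<in> Hom C Z X" "h \<cdot> f = g" using wD(3)[OF g(1)] by blast
    then show ?thesis using epi_cancel[OF f] by metis
  qed
  then show ?thesis unfolding is_cokernel_def d using d kD(1) by simp
qed

text \<open>Together with \<open>subquotientE\<close> this turns subquotients of \<open>M\<close>
  into spans of a mono into \<open>M\<close> and an epi onto \<open>Z\<close>, a form that can be
  composed. The kernel of the epi supplies the smaller subobject.\<close>

lemma epi_subquotient:
  assumes "is_mono C m" "m \<in> Hom C Y M" "is_epi C f" "f \<in> Hom C Y Z"
  shows "subquotient C Z M"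
proof -
  obtain K k where k: "is_kernel C k f" "k \<in> Hom C K Y" using kernel_obtain assms(4) .
  have "is_mono C k" using kernelD(2)[OF k(1) assms(4) k(2)] .
  moreover have "is_cokernel C f k" using epi_cokernel_of_kernel[OF assms(3,4) k] .
  moreover have "Cod C m = M" "Dom C m = Y" "Cod C k = Y" "Cod C f = Z"
    using assms(2,4) k(2) by (simp_all add: Hom_def)
  ultimately show ?thesis
    unfolding subquotient_def using assms(1) by (intro exI[of _ m] exI[of _ k] exI[of _ f]) simp
qed

lemma subquotient_refl:
  assumes "M \<in> Ob C" shows "subquotient C M M"
proof -
  have "is_epi C (Idt C M)"
    by (rule epiI[OF Idt_Hom[OF assms]]) (simp add: Comp_Idt)
  then show ?thesis using epi_subquotient[OF Idt_mono Idt_Hom] Idt_Hom assms by blast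
qed

lemma subquotientE:
  assumes "subquotient C K M"
  obtains Y m q where "m \<in> Hom C Y M" "is_mono C m" "q \<in> Hom C Y K" "is_epi C q"
proof -
  obtain m l q where mlq: "is_mono C m" "Cod C m = M" "is_mono C l" "Cod C l = Dom C m"
    "is_cokernel C q l" "Cod C q = K"
    using assms unfolding subquotient_def by blast
  then have m: "m \<in> Hom C (Dom C m) M" and l: "l \<in> Hom C (Dom C l) (Dom C m)"
    and q: "q \<in> Hom C (Dom C m) K"
    by (auto simp: is_mono_def is_cokernel_def Hom_def)
  show ?thesis using that[OF m mlq(1) q cokernelD(2)[OF mlq(5) l q]] .
qed

text \<open>\<open>P\<close> is the preimage of \<open>Z\<close> under \<open>q\<close>, built as
  the kernel of the composite from \<open>Y\<close> to \<open>K/Z\<close>, and \<open>e\<close> is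
  the restriction of \<open>q\<close>. The substance is that \<open>e\<close> is still epi.\<close>

lemma epi_pullback_along_mono:
  assumes q: "q \<in> Hom C Y K" "is_epi C q" and n: "n \<in> Hom C Z K" "is_mono C n"
  obtains P k e where "k \<in> Hom C P Y" "is_mono C k" "e \<in> Hom C P Z" "is_epi C e" "q \<cdot> k = n \<cdot> e"
proof -
  obtain D c where c: "is_cokernel C c n" "c \<in> Hom C K D" using cokernel_obtain n(1) .
  note cD = cokernelD[OF c(1) n(1) c(2)]
  have cq: "c \<cdot> q \<in> Hom C Y D" "is_epi C (c \<cdot> q)"
    using Comp_Hom[OF q(1) c(2)] epi_comp[OF q(2) cD(2) q(1) c(2)] by auto
  obtain P k where k: "is_kernel C k (c \<cdot> q)" "k \<in> Hom C P Y" using kernel_obtain cq(1) .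
  note kD = kernelD[OF k(1) cq(1) k(2)]
  have qk: "q \<cdot> k \<in> Hom C P K" using Comp_Hom k(2) q(1) by blast
  have "c \<cdot> (q \<cdot> k) = Zer C P D" using kD(1) Comp_assoc[OF k(2) q(1) c(2)] by simp
  then obtain e where e: "e \<in> Hom C P Z" "n \<cdot> e = q \<cdot> k"
    using mono_kernel_cokernel[OF n(2,1) c qk] by blast
  \<comment> \<open>Image factorization of \<open>e\<close>: the quotient \<open>E\<close> of
    \<open>P\<close> by the kernel of \<open>e\<close> embeds into \<open>Z\<close> by
    \<open>t\<close>.\<close>
  obtain R r where r: "is_kernel C r e" "r \<in> Hom C R P" using kernel_obtain e(1) .
  note rD = kernelD[OF r(1) e(1) r(2)]
  obtain E p where p: "is_cokernel C p r" "p \<in> Hom C P E" using cokernel_obtain r(2) .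
  note pD = cokernelD[OF p(1) r(2) p(2)]
  obtain t where t: "t \<in> Hom C E Z" "t \<cdot> p = e" using pD(3)[OF e(1) rD(1)] by blast
  have t_mono: "is_mono C t" by (rule coimage_mono[OF e(1) r(2) p t rD(3)])
  have nt: "n \<cdot> t \<in> Hom C E K" "is_mono C (n \<cdot> t)"
    using Comp_Hom[OF t(1) n(1)] mono_comp[OF t_mono n(2) t(1) n(1)] by auto
  \<comment> \<open>The image of \<open>e\<close> is all of \<open>Z\<close>: the cokernel of \<open>E \<rightarrow> K\<close> kills \<open>Z\<close>,
    because \<open>c \<cdot> q\<close> is the cokernel of \<open>k\<close>.\<close>
  obtain X d where d: "is_cokernel C d (n \<cdot> t)" "d \<in> Hom C K X" using cokernel_obtain nt(1) .
  have X: "X \<in> Ob C" using Hom_Ob d(2) by blast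
  have dq: "d \<cdot> q \<in> Hom C Y X" using Comp_Hom q(1) d(2) by blast
  have "(d \<cdot> q) \<cdot> k = d \<cdot> (n \<cdot> e)" using Comp_assoc[OF k(2) q(1) d(2)] e(2) by simp
  also have "\<dots> = d \<cdot> ((n \<cdot> t) \<cdot> p)" using Comp_assoc[OF p(2) t(1) n(1)] t(2) by simp
  also have "\<dots> = (d \<cdot> (n \<cdot> t)) \<cdot> p" using Comp_assoc[OF p(2) nt(1) d(2)] by simp
  also have "\<dots> = Zer C P X" using cokernelD(1)[OF d(1) nt(1) d(2)] Zer_Comp[OF p(2) X] by simp
  finally obtain s where s: "s \<in> Hom C D X" "s \<cdot> (c \<cdot> q) = d \<cdot> q"
    using cokernelD(3)[OF epi_cokernel_of_kernel[OF cq(2,1) k] k(2) cq(1) dq] by blast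
  have "(s \<cdot> c) \<cdot> q = d \<cdot> q" using s Comp_assoc[OF q(1) c(2) s(1)] by simp
  then have "s \<cdot> c = d" using epi_cancel[OF q(2,1) Comp_Hom[OF c(2) s(1)] d(2)] by blast
  then have "d \<cdot> n = Zer C Z X"
    using Comp_assoc[OF n(1) c(2) s(1)] cD(1) Comp_Zer[OF s(1)] Hom_Ob n(1) by metis
  \<comment> \<open>The mono \<open>n \<cdot> t\<close> is a kernel of its cokernel
    \<open>d\<close>, so \<open>n\<close>, being killed by \<open>d\<close>, factors through it.
    Cancelling \<open>n\<close> makes \<open>z\<close> a right inverse of \<open>t\<close>, whence
    \<open>t\<close> is epi.\<close>
  then obtain z where z: "z \<in> Hom C Z E" "n \<cdot> t \<cdot> z = n"
    using mono_kernel_cokernel[OF nt(2,1) d n(1)] by blast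
  have Z: "Z \<in> Ob C" using Hom_Ob n(1) by blast
  have "n \<cdot> (t \<cdot> z) = n \<cdot> Idt C Z"
    using z(2) Comp_assoc[OF z(1) t(1) n(1)] Comp_Idt[OF n(1)] by simp
  then have tz: "t \<cdot> z = Idt C Z"
    using mono_cancel[OF n(2,1) Comp_Hom[OF z(1) t(1)] Idt_Hom[OF Z]] by blast
  have "is_epi C t"
  proof (rule epiI[OF t(1)])
    fix W g h assume gh: "g \<in> Hom C Z W" "h \<in> Hom C Z W" "g \<cdot> t = h \<cdot> t"
    then have "g \<cdot> (t \<cdot> z) = h \<cdot> (t \<cdot> z)" using Comp_assoc[OF z(1) t(1)] by metis
    then show "g = h" using tz Comp_Idt gh(1,2) by simp
  qed
  then have "is_epi C e" using epi_comp[OF pD(2) _ p(2) t(1)] t(2) by simp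
  then show ?thesis using that[OF k(2) kD(2) e(1)] e(2) by simp
qed

text \<open>Two spans compose through the preimage \<open>P\<close>: it embeds into \<open>M\<close>
  via \<open>Y\<close> and maps onto \<open>L\<close> via \<open>Z\<close>.\<close>

lemma subquotient_trans:
  assumes "subquotient C L K" "subquotient C K M"
  shows "subquotient C L M"
proof -
  obtain Y m q where m: "m \<in> Hom C Y M" "is_mono C m" and q: "q \<in> Hom C Y K" "is_epi C q"
    using subquotientE assms(2) .
  obtain Z n r where n: "n \<in> Hom C Z K" "is_mono C n" and r: "r \<in> Hom C Z L" "is_epi C r"
    using subquotientE assms(1) .
  obtain P k e where k: "k \<in> Hom C P Y" "is_mono C k" and e: "e \<in> Hom C P Z" "is_epi C e"
    using epi_pullback_along_mono q n .
  show ?thesis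
    using epi_subquotient[OF mono_comp[OF k(2) m(2) k(1) m(1)] Comp_Hom[OF k(1) m(1)]
        epi_comp[OF e(2) r(2) e(1) r(1)] Comp_Hom[OF e(1) r(1)]] .
qed

lemma ASpec_open_ASupp: "ASpec_open C (ASupp C M)"
  unfolding ASpec_open_def
proof (intro conjI ballI)
  show "ASupp C M \<subseteq> ASpec C" by (auto simp: ASupp_def)
  fix \<alpha> assume "\<alpha> \<in> ASupp C M"
  then obtain H where H: "H \<in> \<alpha>" "subquotient C H M" by (auto simp: ASupp_def)
  then have "ASupp C H \<subseteq> ASupp C M" using subquotient_trans by (fastforce simp: ASupp_def)
  with H show "\<exists>H\<in>\<alpha>. ASupp C H \<subseteq> ASupp C M" by blast
qed

text \<open>This provides an open neighbourhood for every atom; \<open>alexandroff_space\<close>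
  speaks of nonempty families of open sets.\<close>

lemma ASpec_open_ASpec: "ASpec_open C (ASpec C)"
  unfolding ASpec_open_def
proof (intro conjI ballI)
  fix \<alpha> assume "\<alpha> \<in> ASpec C"
  then obtain H where "H \<in> \<alpha>"
    using in_quotient_imp_non_empty[OF atom_rel_equiv] by (fastforce simp: ASpec_def)
  then show "\<exists>H\<in>\<alpha>. ASupp C H \<subseteq> ASpec C" by (auto simp: ASupp_def)
qed simp

text \<open>By the definition of specialization, the up-set is the intersection of all open
  neighbourhoods of \<alpha>.\<close>

lemma alexandroff_ASpec_open_up_set:
  assumes "alexandroff_space (ASpec_topology C)" "\<alpha> \<in> ASpec C"
  shows "ASpec_open C {\<beta> \<in> ASpec C. specialization_le (ASpec_topology C) \<alpha> \<beta>}"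
proof -
  let ?\<U> = "{\<Phi>. ASpec_open C \<Phi> \<and> \<alpha> \<in> \<Phi>}"
  \<comment> \<open>This member makes the family nonempty and keeps its intersection inside
    \<open>ASpec C\<close>.\<close>
  have "ASpec C \<in> ?\<U>" using ASpec_open_ASpec assms(2) by blast
  then have "{\<beta> \<in> ASpec C. specialization_le (ASpec_topology C) \<alpha> \<beta>} = \<Inter>?\<U>" and ne: "?\<U> \<noteq> {}"
    unfolding specialization_le_def openin_ASpec_topology by blast+
  moreover have "ASpec_open C (\<Inter>?\<U>)"
    using assms(1)[unfolded alexandroff_space_def openin_ASpec_topology, rule_format, of ?\<U>] ne
    by blast
  ultimately show ?thesis by simp
qed

end

theorem corollary2p4:
  fixes C :: "('o, 'm) addcat" and U :: "'i set" and \<alpha> :: "'o set"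
  assumes "locally_noetherian_grothendieck_category C U"
    and "alexandroff_space (ASpec_topology C)"
    and "\<alpha> \<in> ASpec C"
  shows "\<forall>H. monoform C H \<and> \<alpha> = atom_of C H \<longrightarrow>
    (\<exists>h. is_mono C h \<and> Cod C h = H \<and> monoform C (Dom C h) \<and>
         ASupp C (Dom C h) = {\<beta> \<in> ASpec C. specialization_le (ASpec_topology C) \<alpha> \<beta>})"
proof (intro allI impI)
  fix H assume H: "monoform C H \<and> \<alpha> = atom_of C H"
  interpret locally_noetherian_grothendieck_category C U by (fact assms(1))
  let ?V = "{\<beta> \<in> ASpec C. specialization_le (ASpec_topology C) \<alpha> \<beta>}"
  have "\<alpha> \<in> ?V" using assms(3) by (simp add: specialization_le_def)
  then obtain H' where H': "H' \<in> \<alpha>" "ASupp C H' \<subseteq> ?V"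
    using alexandroff_ASpec_open_up_set[OF assms(2,3)] unfolding ASpec_open_def by meson
  then have "atom_equivalent C H H'" using H by (simp add: atom_of_def atom_rel_def)
  \<comment> \<open>\<open>L\<close>, embedded in \<open>H\<close> by \<open>s\<close>, is the
    required subobject; the embedding \<open>t\<close> into \<open>H'\<close> will bound its support
    from above.\<close>
  then obtain L s t where L: "\<not> is_zero_object C L" "s \<in> Hom C L H" "is_mono C s"
      "t \<in> Hom C L H'" "is_mono C t"
    unfolding atom_equivalent_iff by blast
  have mL: "monoform C L" using monoform_subobject[OF _ L(2,3,1)] H by blast
  then have L_Ob: "L \<in> Ob C" by (simp add: monoform_def)
  \<comment> \<open>The nonzero subobject shared by \<open>H\<close> and \<open>L\<close> is
    \<open>L\<close> itself, via \<open>s\<close> and the identity.\<close>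
  then have "atom_equivalent C H L"
    unfolding atom_equivalent_iff using Idt_Hom Idt_mono L(1-3) by blast
  then have "L \<in> \<alpha>" using mL H by (simp add: atom_of_def atom_rel_def)
  then have "\<alpha> \<in> ASupp C L" using assms(3) subquotient_refl[OF L_Ob] by (auto simp: ASupp_def)
  then have "?V \<subseteq> ASupp C L"
    using ASpec_open_ASupp unfolding specialization_le_def openin_ASpec_topology by blast
  moreover have "ASupp C L \<subseteq> ?V" using ASupp_subobject[OF L(4,5)] H'(2) by blast
  ultimately have "ASupp C L = ?V" by blast
  with mL L(2,3) show "\<exists>h. is_mono C h \<and> Cod C h = H \<and> monoform C (Dom C h) \<and>
         ASupp C (Dom C h) = ?V"
    using HomD by metis
qed

end
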